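(* Let $p>2$ be a prime, let $G$ be a $p$-group whose commutator subgroup has order $p$, and let $F$ be a field of characteristic $p$. Then for every integer $n\ge 0$, $$\gamma_n(FG^-)=\gamma_n(FG)\cap FG^-.$$
   Context: $FG$ is the group algebra, with the classical involution $*$: the $F$-linear extension of $g\mapsto g^{-1}$, $g\in G$. $FG^-=\{x\in FG : x^*=-x\}$ is the set of skew symmetric elements; it is a Lie subalgebra of $FG$ under the Lie commutator $[x,y]=xy-yx$. Lie commutators are left-normed: $[x_0,x_1,\dots,x_n]=[[x_0,x_1,\dots,x_{n-1}],x_n]$. For $L=FG$ or $L=FG^-$, the term $\gamma_n(L)$ of the lower Lie central series is the $F$-linear span of all $[x_0,x_1,\dots,x_n]$ with $x_i\in L$; in particular $\gamma_0(L)=L$ (so the indexing starts at $0$ and $\gamma_n$ involves $n+1$ entries). *)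

theory Defs
  imports
    "HOL-Algebra.Algebra"
    "HOL-Library.Poly_Mapping"
    "HOL-Computational_Algebra.Primes"
begin

text \<open>
  A \<open>p\<close>-group is not assumed to be finite: every element has order a power of \<open>p\<close>.
  The library's \<open>group.ord\<close> is 0 for elements of infinite order, which \<open>p ^ k\<close> excludes.
\<close>

definition p_group :: "nat \<Rightarrow> ('g, 'm) monoid_scheme \<Rightarrow> bool" where
  "p_group p G \<longleftrightarrow> group G \<and> (\<forall>x\<in>carrier G. \<exists>k::nat. group.ord G x = p ^ k)"

text \<open>
  Elements of \<open>FG\<close> are the finitely supported functions with support in \<open>carrier G\<close>. The
  multiplication of type \<^typ>\<open>'g \<Rightarrow>\<^sub>0 'f\<close> in the library is convolution along the type class
  addition of \<open>'g\<close>; it is not used here, since the group operation is that of the record \<open>G\<close>.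
\<close>

definition group_algebra :: "('g, 'm) monoid_scheme \<Rightarrow> ('g \<Rightarrow>\<^sub>0 'f::field) set" where
  "group_algebra G = {x. Poly_Mapping.keys x \<subseteq> carrier G}"

definition ga_scale :: "'f::field \<Rightarrow> ('g \<Rightarrow>\<^sub>0 'f) \<Rightarrow> ('g \<Rightarrow>\<^sub>0 'f)" where
  "ga_scale c x = Poly_Mapping.map ((*) c) x"

definition ga_mult ::
    "('g, 'm) monoid_scheme \<Rightarrow> ('g \<Rightarrow>\<^sub>0 'f::field) \<Rightarrow> ('g \<Rightarrow>\<^sub>0 'f) \<Rightarrow> ('g \<Rightarrow>\<^sub>0 'f)" where
  "ga_mult G x y =
     (\<Sum>g\<in>Poly_Mapping.keys x. \<Sum>h\<in>Poly_Mapping.keys y.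
        Poly_Mapping.single (g \<otimes>\<^bsub>G\<^esub> h) (Poly_Mapping.lookup x g * Poly_Mapping.lookup y h))"

definition ga_star :: "('g, 'm) monoid_scheme \<Rightarrow> ('g \<Rightarrow>\<^sub>0 'f::field) \<Rightarrow> ('g \<Rightarrow>\<^sub>0 'f)" where
  "ga_star G x =
     (\<Sum>g\<in>Poly_Mapping.keys x. Poly_Mapping.single (inv\<^bsub>G\<^esub> g) (Poly_Mapping.lookup x g))"

definition skew_elements :: "('g, 'm) monoid_scheme \<Rightarrow> ('g \<Rightarrow>\<^sub>0 'f::field) set" where
  "skew_elements G = {x \<in> group_algebra G. ga_star G x = - x}"

definition lie_bracket ::
    "('g, 'm) monoid_scheme \<Rightarrow> ('g \<Rightarrow>\<^sub>0 'f::field) \<Rightarrow> ('g \<Rightarrow>\<^sub>0 'f) \<Rightarrow> ('g \<Rightarrow>\<^sub>0 'f)" where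
  "lie_bracket G x y = ga_mult G x y - ga_mult G y x"

text \<open>\<open>lie_commutator G x n\<close> is the left-normed commutator of the \<open>n + 1\<close> entries
  \<open>x 0, \<dots>, x n\<close>.\<close>

primrec lie_commutator ::
    "('g, 'm) monoid_scheme \<Rightarrow> (nat \<Rightarrow> ('g \<Rightarrow>\<^sub>0 'f::field)) \<Rightarrow> nat \<Rightarrow> ('g \<Rightarrow>\<^sub>0 'f)" where
  "lie_commutator G x 0 = x 0"
| "lie_commutator G x (Suc n) = lie_bracket G (lie_commutator G x n) (x (Suc n))"

definition lower_lie_central ::
    "('g, 'm) monoid_scheme \<Rightarrow> nat \<Rightarrow> ('g \<Rightarrow>\<^sub>0 'f::field) set \<Rightarrow> ('g \<Rightarrow>\<^sub>0 'f) set" where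
  "lower_lie_central G n L =
     module.span ga_scale {lie_commutator G x n | x. \<forall>i\<le>n. x i \<in> L}"

lemma lookup_ga_scale [simp]:
  "Poly_Mapping.lookup (ga_scale c x) g = c * Poly_Mapping.lookup x g"
  by (simp add: ga_scale_def Poly_Mapping.map.rep_eq when_def)

text \<open>This makes \<^term>\<open>module.span ga_scale\<close> the \<open>F\<close>-linear span.\<close>

global_interpretation ga: vector_space "ga_scale :: 'f::field \<Rightarrow> ('g \<Rightarrow>\<^sub>0 'f) \<Rightarrow> ('g \<Rightarrow>\<^sub>0 'f)"
  by unfold_locales
    (auto intro!: poly_mapping_eqI simp: lookup_add distrib_left distrib_right)

lemma ga_mult_single:
  "ga_mult G (Poly_Mapping.single g a) (Poly_Mapping.single h b) =
     Poly_Mapping.single (g \<otimes>\<^bsub>G\<^esub> h) (a * b)"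
  by (simp add: ga_mult_def)

lemma ga_star_single:
  "ga_star G (Poly_Mapping.single g a) = Poly_Mapping.single (inv\<^bsub>G\<^esub> g) a"
  by (simp add: ga_star_def)

end

theory Submission
  imports Defs "HOL-Number_Theory.Residues"
begin

text \<open>
  The derived subgroup \<open>D\<close> has order \<open>p\<close> and \<open>G\<close> is a \<open>p\<close>-group, so \<open>D\<close> is central and each of
  its elements other than \<open>\<one>\<close> generates it. Fix such a generator \<open>s\<close>, put \<open>z = s\<^sup>2\<close> and
  \<open>v = z - z\<inverse>\<close> in the group algebra; then \<open>v\<close> is central and \<open>v\<^sup>* = - v\<close>. Since \<open>p\<close> is odd, \<open>z\<^sup>2\<close>
  generates \<open>D\<close> as well.

  Brackets of skew elements are skew, which gives one inclusion. For the other, bound \<open>\<gamma>\<^sub>n(FG)\<close> from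
  above first. For group elements \<open>g\<close>, \<open>h\<close> there is \<open>m\<close> with \<open>gh = z\<^bsup>2m\<^esup> hg\<close>, so
  \<open>[g, h] = (z\<^bsup>2m\<^esup> - 1) hg\<close>, and \<open>v\<close> divides \<open>z\<^bsup>2m\<^esup> - 1\<close>. If \<open>g\<close> and \<open>h\<close> do not commute then \<open>hg\<close> is
  not central. Hence \<open>\<gamma>\<^sub>n(FG) \<subseteq> v\<^sup>n N\<close> for \<open>n \<ge> 1\<close>, where \<open>N\<close> is the span of the noncentral group
  elements (\<open>lower_lie_central_subset_vpow\<close>). A skew element \<open>w = v\<^sup>n y\<close> with \<open>y \<in> N\<close> satisfies
  \<open>2w = w - w\<^sup>* = v\<^sup>n (y - (-1)\<^sup>n y\<^sup>*)\<close>. As 2 is invertible, \<open>w\<close> is a combination of the elements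
  \<open>v\<^sup>n (x - (-1)\<^sup>n x\<inverse>)\<close> with \<open>x\<close> noncentral, and it remains to find these in \<open>\<gamma>\<^sub>n(FG\<^sup>-)\<close>.

  That is \<open>vpow_signed_pair_in_skew_central\<close>, by induction on \<open>n\<close>. Write \<open>\<epsilon> = (-1)\<^sup>n\<close> and
  \<open>S(x) = x + \<epsilon> x\<inverse>\<close>. If \<open>gh = z\<^sup>2 hg\<close>, then the bracket of \<open>v\<^sup>n (g - \<epsilon> g\<inverse>)\<close> and \<open>h - h\<inverse>\<close> is
  \<open>v\<^bsup>n+1\<^esup> (S(z h g) + S(z g h\<inverse>))\<close>. So the induction gives sums of two of the wanted elements, for
  suitable pairs of group elements. Given a noncentral \<open>a\<close>, write it as \<open>d\<^sup>2\<close> and choose \<open>e\<close> with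
  \<open>de = z ed\<close>; then any two of \<open>d\<^sup>2\<close>, \<open>e\<^sup>2\<close> and \<open>de\<^sup>2d\<close> form such a pair, and the three sums together
  give \<open>2 S(d\<^sup>2)\<close>, hence \<open>S(a)\<close>.

  The choice of \<open>g\<close> and \<open>h\<close> comes from the elements \<open>w(i, j) = s\<^bsup>-ij\<^esup> d\<^sup>i e\<^sup>j\<close>, for which
  \<open>w(i, j) w(k, l) = s\<^bsup>il-jk\<^esup> w(i+k, j+l)\<close> and \<open>w(i, j)\<inverse> = w(-i, -j)\<close>. For \<open>il - jk = 2\<close>, the
  elements \<open>g = w(i, j)\<close> and \<open>h = w(k, l)\<close> satisfy \<open>gh = z\<^sup>2 hg\<close>, and \<open>z h g\<close> and \<open>z g h\<inverse>\<close> are the elements \<open>w\<close> at the sum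
  and the difference of the two indices. The pairs
  \<open>(1,1), (-1,1)\<close>; \<open>(2,1), (0,1)\<close>; \<open>(1,2), (-1,0)\<close> yield \<open>w(0,2)\<close>, \<open>w(2,0)\<close> and \<open>w(2,2)\<close>, two at a
  time.
\<close>

section \<open>Linearity in the group algebra\<close>

abbreviation basis :: "'g \<Rightarrow> ('g \<Rightarrow>\<^sub>0 'f::field)" where
  "basis g \<equiv> Poly_Mapping.single g 1"

lemma ga_scale_single [simp]:
  "ga_scale c (Poly_Mapping.single g a) = Poly_Mapping.single g (c * a)"
  by (intro poly_mapping_eqI) (simp add: lookup_single when_def)

text \<open>
  Identities that are additive in each argument thereby reduce to group elements with a coefficient.
  Associativity and the rules for the involution are proved in this way.
\<close>

lemma supported_induct [consumes 1, case_names zero single add]: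
  fixes x :: "'g \<Rightarrow>\<^sub>0 'f::field"
  assumes "Poly_Mapping.keys x \<subseteq> A"
    and "P 0"
    and "\<And>g c. g \<in> A \<Longrightarrow> P (Poly_Mapping.single g c)"
    and "\<And>x y. Poly_Mapping.keys x \<subseteq> A \<Longrightarrow> Poly_Mapping.keys y \<subseteq> A \<Longrightarrow> P x \<Longrightarrow> P y \<Longrightarrow> P (x + y)"
  shows "P x"
proof -
  let ?t = "\<lambda>g. Poly_Mapping.single g (Poly_Mapping.lookup x g)"
  have "Poly_Mapping.keys (sum ?t B) \<subseteq> A \<and> P (sum ?t B)" if "B \<subseteq> Poly_Mapping.keys x" for B
    using finite_subset[OF that finite_keys] that
  proof (induction B rule: finite_induct)
    case (insert g B)
    then have g: "g \<in> A" and IH: "Poly_Mapping.keys (sum ?t B) \<subseteq> A" "P (sum ?t B)"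
      using assms(1) by auto
    have "Poly_Mapping.keys (?t g) \<subseteq> A" using g by simp
    moreover from this have "P (?t g + sum ?t B)"
      using assms(3)[OF g] IH by (intro assms(4))
    ultimately show ?case
      using insert.hyps IH Poly_Mapping.keys_add[of "?t g" "sum ?t B"] by auto
  qed (use assms(2) in simp)
  then have "P (sum ?t (Poly_Mapping.keys x))" by blast
  moreover have "sum ?t (Poly_Mapping.keys x) = x"
    by (intro poly_mapping_eqI)
      (simp add: lookup_sum lookup_single when_def sum.delta in_keys_iff)
  ultimately show ?thesis by simp
qed

lemma group_algebra_induct [consumes 1, case_names zero single add]:
  fixes x :: "'g \<Rightarrow>\<^sub>0 'f::field"
  assumes "x \<in> group_algebra G"
    and "P 0"
    and "\<And>g c. g \<in> carrier G \<Longrightarrow> P (Poly_Mapping.single g c)"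
    and "\<And>x y. x \<in> group_algebra G \<Longrightarrow> y \<in> group_algebra G \<Longrightarrow> P x \<Longrightarrow> P y \<Longrightarrow> P (x + y)"
  shows "P x"
  using assms(1) unfolding group_algebra_def mem_Collect_eq
  by (induction rule: supported_induct) (use assms in \<open>auto simp: group_algebra_def\<close>)

lemma subspace_supported:
  "ga.subspace {x :: 'g \<Rightarrow>\<^sub>0 'f::field. Poly_Mapping.keys x \<subseteq> A}"
proof (intro ga.subspaceI; clarsimp)
  fix x y :: "'g \<Rightarrow>\<^sub>0 'f" and g
  assume "Poly_Mapping.keys x \<subseteq> A" "Poly_Mapping.keys y \<subseteq> A" "g \<in> Poly_Mapping.keys (x + y)"
  then show "g \<in> A" using Poly_Mapping.keys_add[of x y] by blast
next
  fix x :: "'g \<Rightarrow>\<^sub>0 'f" and g c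
  assume "Poly_Mapping.keys x \<subseteq> A" "g \<in> Poly_Mapping.keys (ga_scale c x)"
  then show "g \<in> A" by (auto simp: in_keys_iff)
qed

lemma subspace_group_algebra: "ga.subspace (group_algebra G)"
  unfolding group_algebra_def by (rule subspace_supported)

lemmas group_algebra_zero = ga.subspace_0[OF subspace_group_algebra]
  and group_algebra_add = ga.subspace_add[OF subspace_group_algebra]
  and group_algebra_diff = ga.subspace_diff[OF subspace_group_algebra]

lemma single_in_group_algebra: "g \<in> carrier G \<Longrightarrow> Poly_Mapping.single g c \<in> group_algebra G"
  by (simp add: group_algebra_def)

text \<open>
  The supports shrink under cancellation, so additivity is only visible when both sums run over a
  common larger index set.
\<close>

lemma ga_mult_eq_sum:
  assumes "finite A" "finite B" "Poly_Mapping.keys x \<subseteq> A" "Poly_Mapping.keys y \<subseteq> B"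
  shows "ga_mult G x y = (\<Sum>g\<in>A. \<Sum>h\<in>B.
    Poly_Mapping.single (g \<otimes>\<^bsub>G\<^esub> h) (Poly_Mapping.lookup x g * Poly_Mapping.lookup y h))"
proof -
  have "(\<Sum>h\<in>Poly_Mapping.keys y.
      Poly_Mapping.single (g \<otimes>\<^bsub>G\<^esub> h) (Poly_Mapping.lookup x g * Poly_Mapping.lookup y h))
    = (\<Sum>h\<in>B. Poly_Mapping.single (g \<otimes>\<^bsub>G\<^esub> h) (Poly_Mapping.lookup x g * Poly_Mapping.lookup y h))" for g
    using assms by (intro sum.mono_neutral_left) (auto simp: in_keys_iff)
  then show ?thesis
    unfolding ga_mult_def using assms
    by (simp, intro sum.mono_neutral_left) (auto simp: in_keys_iff)
qed

lemma ga_mult_add_left: "ga_mult G (x + y) w = ga_mult G x w + ga_mult G y w"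
proof -
  let ?A = "Poly_Mapping.keys x \<union> Poly_Mapping.keys y"
  have "Poly_Mapping.keys (x + y) \<subseteq> ?A" by (rule Poly_Mapping.keys_add)
  then show ?thesis
    by (simp add: ga_mult_eq_sum[of ?A "Poly_Mapping.keys w"] lookup_add distrib_right
        single_add sum.distrib)
qed

lemma ga_mult_add_right: "ga_mult G w (x + y) = ga_mult G w x + ga_mult G w y"
proof -
  let ?A = "Poly_Mapping.keys x \<union> Poly_Mapping.keys y"
  have "Poly_Mapping.keys (x + y) \<subseteq> ?A" by (rule Poly_Mapping.keys_add)
  then show ?thesis
    by (simp add: ga_mult_eq_sum[of "Poly_Mapping.keys w" ?A] lookup_add distrib_left
        single_add sum.distrib)
qed

lemma ga_mult_scale_left: "ga_mult G (ga_scale c x) w = ga_scale c (ga_mult G x w)"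
proof -
  have "Poly_Mapping.keys (ga_scale c x) \<subseteq> Poly_Mapping.keys x" by (auto simp: in_keys_iff)
  then show ?thesis
    by (simp add: ga_mult_eq_sum[of "Poly_Mapping.keys x" "Poly_Mapping.keys w"]
        ga.scale_sum_right mult.assoc)
qed

lemma ga_mult_scale_right: "ga_mult G w (ga_scale c x) = ga_scale c (ga_mult G w x)"
proof -
  have "Poly_Mapping.keys (ga_scale c x) \<subseteq> Poly_Mapping.keys x" by (auto simp: in_keys_iff)
  then show ?thesis
    by (simp add: ga_mult_eq_sum[of "Poly_Mapping.keys w" "Poly_Mapping.keys x"]
        ga.scale_sum_right mult.left_commute)
qed

lemma ga_mult_zero [simp]: "ga_mult G 0 w = 0" "ga_mult G w 0 = 0"
  by (simp_all add: ga_mult_def)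

lemma ga_mult_diff_left: "ga_mult G (x - y) w = ga_mult G x w - ga_mult G y w"
  using ga_mult_add_left[of G "x - y" y w] by simp

lemma ga_mult_diff_right: "ga_mult G w (x - y) = ga_mult G w x - ga_mult G w y"
  using ga_mult_add_right[of G w "x - y" y] by simp

lemma ga_mult_minus: "ga_mult G (- x) w = - ga_mult G x w" "ga_mult G w (- x) = - ga_mult G w x"
  using ga_mult_diff_left[of G 0 x w] ga_mult_diff_right[of G w 0 x] by simp_all

lemma ga_star_eq_sum:
  assumes "finite A" "Poly_Mapping.keys x \<subseteq> A"
  shows "ga_star G x = (\<Sum>g\<in>A. Poly_Mapping.single (inv\<^bsub>G\<^esub> g) (Poly_Mapping.lookup x g))"
  unfolding ga_star_def using assms
  by (intro sum.mono_neutral_left) (auto simp: in_keys_iff)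

lemma ga_star_add: "ga_star G (x + y) = ga_star G x + ga_star G y"
proof -
  let ?A = "Poly_Mapping.keys x \<union> Poly_Mapping.keys y"
  have "Poly_Mapping.keys (x + y) \<subseteq> ?A" by (rule Poly_Mapping.keys_add)
  then show ?thesis
    by (simp add: ga_star_eq_sum[of ?A] lookup_add single_add sum.distrib)
qed

lemma ga_star_scale: "ga_star G (ga_scale c x) = ga_scale c (ga_star G x)"
proof -
  have "Poly_Mapping.keys (ga_scale c x) \<subseteq> Poly_Mapping.keys x" by (auto simp: in_keys_iff)
  then show ?thesis
    by (simp add: ga_star_eq_sum[of "Poly_Mapping.keys x"] ga.scale_sum_right)
qed

lemma ga_star_zero [simp]: "ga_star G 0 = 0"
  by (simp add: ga_star_def)

lemma ga_star_diff: "ga_star G (x - y) = ga_star G x - ga_star G y"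
  using ga_star_add[of G "x - y" y] by simp

lemma subspace_skew: "ga.subspace (skew_elements G)"
  by (intro ga.subspaceI)
    (auto simp: skew_elements_def group_algebra_zero group_algebra_add ga_star_add ga_star_scale
      intro: ga.subspace_scale[OF subspace_group_algebra])

lemma lie_bracket_add_left: "lie_bracket G (x + y) w = lie_bracket G x w + lie_bracket G y w"
  by (simp add: lie_bracket_def ga_mult_add_left ga_mult_add_right)

lemma lie_bracket_add_right: "lie_bracket G w (x + y) = lie_bracket G w x + lie_bracket G w y"
  by (simp add: lie_bracket_def ga_mult_add_left ga_mult_add_right)

lemma lie_bracket_scale_left: "lie_bracket G (ga_scale c x) w = ga_scale c (lie_bracket G x w)"
  by (simp add: lie_bracket_def ga_mult_scale_left ga_mult_scale_right ga.scale_right_diff_distrib)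

lemma lie_bracket_zero [simp]: "lie_bracket G 0 w = 0" "lie_bracket G w 0 = 0"
  by (simp_all add: lie_bracket_def)

section \<open>Lower central series of a subspace\<close>

lemma lower_lie_central_zero:
  assumes "ga.subspace L"
  shows "lower_lie_central G 0 L = L"
proof -
  have "{lie_commutator G x 0 | x. \<forall>i\<le>0. x i \<in> L} = L"
    by (auto intro: exI[of _ "\<lambda>_. _"])
  then show ?thesis
    using assms by (simp only: lower_lie_central_def ga.span_eq_iff)
qed

lemma lower_lie_central_bracket:
  assumes "y \<in> lower_lie_central G n L" "w \<in> L"
  shows "lie_bracket G y w \<in> lower_lie_central G (Suc n) L"
  using assms(1) unfolding lower_lie_central_def
proof (induction rule: ga.span_induct_alt)
  case base
  then show ?case by (simp add: ga.span_zero)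
next
  case (step c x y)
  then obtain f where f: "x = lie_commutator G f n" "\<forall>i\<le>n. f i \<in> L" by auto
  have "lie_commutator G (f(Suc n := w)) m = lie_commutator G f m" if "m \<le> n" for m
    using that by (induction m) auto
  then have "lie_bracket G x w = lie_commutator G (f(Suc n := w)) (Suc n)"
    using f by simp
  then have "lie_bracket G x w \<in> {lie_commutator G x (Suc n) | x. \<forall>i\<le>Suc n. x i \<in> L}"
    using f assms(2) by (intro CollectI exI[of _ "f(Suc n := w)"]) auto
  then show ?case
    using step.IH
    by (simp add: lie_bracket_add_left lie_bracket_scale_left ga.span_add ga.span_scale ga.span_base)
qed

lemma lower_lie_central_mono: "L \<subseteq> M \<Longrightarrow> lower_lie_central G n L \<subseteq> lower_lie_central G n M"
  unfolding lower_lie_central_def by (intro ga.span_mono) blast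

lemma lower_lie_central_subset:
  assumes "ga.subspace M" "\<And>x. \<forall>i\<le>n. x i \<in> L \<Longrightarrow> lie_commutator G x n \<in> M"
  shows "lower_lie_central G n L \<subseteq> M"
  unfolding lower_lie_central_def using assms by (intro ga.span_minimal) auto

section \<open>The group algebra as an algebra with involution\<close>

context group
begin

lemma ga_mult_closed:
  assumes "x \<in> group_algebra G" "y \<in> group_algebra G"
  shows "ga_mult G x y \<in> group_algebra G"
  using assms(1)
proof (induction rule: group_algebra_induct)
  case (single g c)
  show ?case using assms(2)
    by (induction rule: group_algebra_induct)
      (use single in \<open>auto simp: ga_mult_single ga_mult_add_right group_algebra_zero
        intro: single_in_group_algebra group_algebra_add\<close>)
qed (auto simp: ga_mult_add_left group_algebra_zero intro: group_algebra_add)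

lemma ga_mult_assoc:
  assumes "x \<in> group_algebra G" "y \<in> group_algebra G" "w \<in> group_algebra G"
  shows "ga_mult G (ga_mult G x y) w = ga_mult G x (ga_mult G y w)"
  using assms(1)
proof (induction rule: group_algebra_induct)
  case (single g a)
  note g = single
  show ?case using assms(2)
  proof (induction rule: group_algebra_induct)
    case (single h b)
    note h = single
    show ?case using assms(3)
      by (induction rule: group_algebra_induct)
        (use g h in \<open>auto simp: ga_mult_single ga_mult_add_right m_assoc mult.assoc\<close>)
  qed (auto simp: ga_mult_add_left ga_mult_add_right)
qed (auto simp: ga_mult_add_left)

lemma ga_star_mult:
  assumes "x \<in> group_algebra G" "y \<in> group_algebra G"
  shows "ga_star G (ga_mult G x y) = ga_mult G (ga_star G y) (ga_star G x)"
  using assms(1)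
proof (induction rule: group_algebra_induct)
  case (single g a)
  show ?case using assms(2)
    by (induction rule: group_algebra_induct)
      (use single in \<open>auto simp: ga_mult_single ga_star_single ga_mult_add_left
        ga_mult_add_right ga_star_add inv_mult_group mult.commute\<close>)
qed (auto simp: ga_mult_add_left ga_mult_add_right ga_star_add)

lemma lie_bracket_closed:
  "x \<in> group_algebra G \<Longrightarrow> y \<in> group_algebra G \<Longrightarrow> lie_bracket G x y \<in> group_algebra G"
  by (simp add: lie_bracket_def group_algebra_diff ga_mult_closed)

text \<open>
  The involution reverses products, so \<open>[x, y]\<^sup>* = [y\<^sup>*, x\<^sup>*]\<close>; for skew \<open>x\<close> and \<open>y\<close> the two signs
  cancel and \<open>[y, x] = -[x, y]\<close> remains.
\<close>

lemma lie_bracket_skew: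
  "x \<in> skew_elements G \<Longrightarrow> y \<in> skew_elements G \<Longrightarrow> lie_bracket G x y \<in> skew_elements G"
  by (auto simp: skew_elements_def lie_bracket_closed)
    (simp add: lie_bracket_def ga_star_diff ga_star_mult ga_mult_minus)

lemma lower_lie_central_skew:
  "lower_lie_central G n (skew_elements G :: ('a \<Rightarrow>\<^sub>0 'f::field) set) \<subseteq> skew_elements G"
proof (rule lower_lie_central_subset[OF subspace_skew])
  fix x :: "nat \<Rightarrow> 'a \<Rightarrow>\<^sub>0 'f"
  assume "\<forall>i\<le>n. x i \<in> skew_elements G"
  then show "lie_commutator G x n \<in> skew_elements G"
    by (induction n) (auto intro: lie_bracket_skew)
qed

end

section \<open>Groups with central commutators\<close>

lemma fermat_iterated:
  assumes "Factorial_Ring.prime (p::nat)"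
  shows "[r ^ p ^ k = r] (mod p)"
proof (induction k)
  case (Suc k)
  have "[a ^ p = a] (mod p)" for a
  proof (cases "p dvd a")
    case True
    then have "p dvd a ^ p" using prime_gt_0_nat[OF assms] by (meson dvd_power dvd_trans)
    with True show ?thesis by (simp add: cong_def mod_eq_0_iff_dvd)
  next
    case False
    then have "[a * a ^ (p - 1) = a * 1] (mod p)"
      by (intro cong_scalar_left fermat_theorem assms)
    then show ?thesis
      using prime_gt_0_nat[OF assms] by (simp flip: power_Suc)
  qed
  then have "[(r ^ p ^ k) ^ p = r] (mod p)" using Suc cong_trans by blast
  then show ?case by (simp add: mult.commute flip: power_mult)
qed simp

context group
begin

definition noncentral :: "'a set" where
  "noncentral = {d \<in> carrier G. \<exists>x\<in>carrier G. d \<otimes> x \<noteq> x \<otimes> d}"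

lemma commutator_in_derived:
  "x \<in> carrier G \<Longrightarrow> y \<in> carrier G \<Longrightarrow> x \<otimes> y \<otimes> inv x \<otimes> inv y \<in> derived G (carrier G)"
  unfolding derived_def by (intro generate.incl) blast

text \<open>
  The order of \<open>c\<close> is a power of \<open>p\<close> other than \<open>1\<close>, hence at least \<open>p\<close>, and the cyclic group
  generated by \<open>c\<close> lies in \<open>D\<close>.
\<close>

lemma prime_order_subgroup_generator:
  assumes "Factorial_Ring.prime p" "p_group p G" "subgroup D G" "card D = p" "c \<in> D" "c \<noteq> \<one>"
  shows "D = {c [^] (k::nat) | k. True}" and "ord c = p"
proof -
  have c: "c \<in> carrier G" using assms subgroup.subset by blast
  have fin: "finite D" using assms by (metis card.infinite not_prime_0)
  have sub: "generate G {c} \<subseteq> D" using assms by (intro generate_subgroup_incl) auto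
  obtain k where k: "ord c = p ^ k" using assms c unfolding p_group_def by blast
  have "k \<noteq> 0" using k c assms(6) ord_eq_1 by fastforce
  then have "p \<le> ord c" using k prime_gt_1_nat[OF assms(1)] by (simp add: self_le_power)
  then have "generate G {c} = D"
    using sub fin assms(4) generate_pow_card[OF c] by (simp add: card_seteq)
  then show "ord c = p" using assms(4) generate_pow_card[OF c] by simp
  then show "D = {c [^] (k::nat) | k. True}"
    using \<open>generate G {c} = D\<close> generate_pow_nat[OF c] prime_gt_0_nat[OF assms(1)] by simp
qed

text \<open>
  Conjugation by \<open>x\<close> raises \<open>c\<close> to some power \<open>r\<close>. If \<open>x\<close> has order \<open>p\<^sup>k\<close>, iterating gives
  \<open>c = c ^ (r ^ (p ^ k))\<close>, where the exponent is \<open>r\<close> modulo \<open>p\<close> by Fermat; so conjugation fixes \<open>c\<close>.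
\<close>

lemma normal_prime_order_central:
  assumes p: "Factorial_Ring.prime p" "p_group p G" and D: "D \<lhd> G" "card D = p"
    and c: "c \<in> D" and x: "x \<in> carrier G"
  shows "c \<otimes> x = x \<otimes> c"
proof (cases "c = \<one>")
  case False
  have cG: "c \<in> carrier G" using D c normal_imp_subgroup subgroup.subset by blast
  note gen = prime_order_subgroup_generator[OF p normal_imp_subgroup[OF D(1)] D(2) c False]
  have "x \<otimes> c \<otimes> inv x \<in> D" using normal.inv_op_closed2[OF D(1) x c] .
  then obtain r :: nat where r: "x \<otimes> c \<otimes> inv x = c [^] r" using gen(1) by auto
  have conj_c: "x \<otimes> c = c [^] r \<otimes> x"
    using r x cG by (metis inv_solve_right' m_closed nat_pow_closed)
  have conj_pow: "x \<otimes> c [^] i = c [^] (r * i) \<otimes> x" for i :: nat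
  proof (induction i)
    case (Suc i)
    have "x \<otimes> c [^] Suc i = (x \<otimes> c [^] i) \<otimes> c" using x cG by (simp add: m_assoc)
    also have "\<dots> = c [^] (r * i) \<otimes> (x \<otimes> c)" using x cG Suc by (simp add: m_assoc)
    also have "\<dots> = c [^] (r * i + r) \<otimes> x"
      using x cG by (simp add: conj_c nat_pow_mult flip: m_assoc)
    finally show ?case by (simp add: add.commute)
  qed (use x in simp)
  have iter: "x [^] j \<otimes> c = c [^] (r ^ j) \<otimes> x [^] j" for j :: nat
  proof (induction j)
    case (Suc j)
    have "x [^] Suc j \<otimes> c = x \<otimes> (x [^] j \<otimes> c)"
      using x cG by (metis m_assoc nat_pow_Suc2 nat_pow_closed)
    also have "\<dots> = (x \<otimes> c [^] (r ^ j)) \<otimes> x [^] j" using x cG Suc by (simp add: m_assoc)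
    also have "\<dots> = c [^] (r ^ Suc j) \<otimes> (x \<otimes> x [^] j)" using x cG by (simp add: conj_pow m_assoc)
    finally show ?case using x by (metis nat_pow_Suc2)
  qed (use cG in simp)
  obtain k where "ord x = p ^ k" using p x unfolding p_group_def by blast
  then have "x [^] (p ^ k) = \<one>" using pow_ord_eq_1[OF x] by simp
  then have "c [^] (r ^ p ^ k) = c [^] (1::nat)" using iter[of "p ^ k"] cG by simp
  moreover have "c [^] (i::nat) = c [^] j" if "[i = j] (mod p)" for i j
  proof -
    have "[int j = int i] (mod int p)" using that by (simp add: cong_int_iff cong_sym)
    then show ?thesis
      using gen(2) int_pow_eq[OF cG, of "int i" "int j"] by (simp add: int_pow_int cong_iff_dvd_diff)
  qed
  ultimately have "c [^] r = c" using fermat_iterated[OF p(1)] cG by (metis nat_pow_eone)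
  then show ?thesis using conj_c by simp
qed (use x in simp)

text \<open>
  If \<open>a\<close> has odd order \<open>q\<close>, then \<open>a\<close> raised to \<open>(q + 1) / 2\<close> is a square root.
\<close>

lemma p_group_square_root:
  assumes "Factorial_Ring.prime p" "p > 2" "p_group p G" "a \<in> carrier G"
  obtains d where "d \<in> carrier G" "d \<otimes> d = a"
proof -
  obtain k where k: "ord a = p ^ k" using assms unfolding p_group_def by blast
  have "odd (p ^ k)" using assms prime_odd_nat by simp
  then have "(p ^ k + 1) div 2 + (p ^ k + 1) div 2 = p ^ k + 1" by (elim oddE) simp
  then have "a [^] ((p ^ k + 1) div 2) \<otimes> a [^] ((p ^ k + 1) div 2) = a"
    using assms(4) k pow_ord_eq_1[OF assms(4)] by (simp add: nat_pow_mult)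
  then show ?thesis using that assms(4) by blast
qed

end

text \<open>
  What the computation in the group algebra uses of \<open>G\<close>. In the application \<open>s\<close> generates the
  derived subgroup. The group elements are normalised with \<open>s\<close>, and the relations between them
  involve \<open>s\<^sup>2\<close> and \<open>s\<^sup>4\<close>, which are again generators because the order of \<open>s\<close> is odd.
\<close>
locale central_commutators = group G for G (structure) +
  fixes s
  assumes s_closed [simp]: "s \<in> carrier G"
    and s_central: "x \<in> carrier G \<Longrightarrow> s \<otimes> x = x \<otimes> s"
    and commutator_power: "x \<in> carrier G \<Longrightarrow> y \<in> carrier G \<Longrightarrow>
      \<exists>m::nat. x \<otimes> y = (s \<otimes> s \<otimes> (s \<otimes> s)) [^] m \<otimes> (y \<otimes> x)"
    and s_pow4: "s \<otimes> s \<otimes> (s \<otimes> s) \<noteq> \<one>"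
    and noncentral_partner: "d \<in> noncentral \<Longrightarrow> \<exists>e\<in>carrier G. d \<otimes> e = s \<otimes> s \<otimes> (e \<otimes> d)"
    and square_root: "a \<in> carrier G \<Longrightarrow> \<exists>d\<in>carrier G. d \<otimes> d = a"

text \<open>
  Every \<open>c \<noteq> \<one>\<close> in the derived subgroup generates it. Applied to \<open>c = s\<^sup>4\<close>, this writes each
  commutator as a power of \<open>s\<^sup>4\<close>. Applied to the commutator \<open>c\<close> of \<open>d\<close> with an element \<open>h\<close> that does
  not commute with it, it gives \<open>m\<close> with \<open>c\<^sup>m = s\<^sup>2\<close>; as \<open>c\<close> is central, the commutator of \<open>d\<close> and
  \<open>h\<^sup>m\<close> is \<open>c\<^sup>m\<close>.
\<close>

lemma p_group_central_commutators:
  fixes G (structure)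
  assumes p: "Factorial_Ring.prime p" "p > 2" and pG: "p_group p G"
    and card: "card (derived G (carrier G)) = p"
  shows "\<exists>s. central_commutators G s"
proof -
  interpret group G using pG unfolding p_group_def by blast
  let ?D = "derived G (carrier G)"
  have sub: "subgroup ?D G" by (rule derived_is_subgroup) simp
  have D_carrier: "c \<in> carrier G" if "c \<in> ?D" for c using sub that subgroup.subset by blast
  note gen = prime_order_subgroup_generator[OF p(1) pG sub card]
  have "\<not> ?D \<subseteq> {\<one>}" using card p card_mono[of "{\<one>}" ?D] by auto
  then obtain s where s: "s \<in> ?D" "s \<noteq> \<one>" by blast
  have sG: "s \<in> carrier G" using s D_carrier by blast
  have central: "c \<otimes> x = x \<otimes> c" if "c \<in> ?D" "x \<in> carrier G" for c x
    using normal_prime_order_central[OF p(1) pG derived_self_is_normal card that] .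
  have s4: "s \<otimes> s \<otimes> (s \<otimes> s) = s [^] (4::nat)"
    using sG by (simp add: numeral_eq_Suc m_assoc)
  have "\<not> p dvd 2 ^ 2"
  proof
    assume "p dvd 2 ^ 2"
    then have "p dvd 2" by (rule prime_dvd_power_nat[OF p(1)])
    then show False using p(2) by (auto dest: dvd_imp_le)
  qed
  then have s4_ne: "s \<otimes> s \<otimes> (s \<otimes> s) \<noteq> \<one>"
    unfolding s4 using gen(2)[OF s] pow_eq_id[OF sG, of 4] by simp
  have s4_D: "s \<otimes> s \<otimes> (s \<otimes> s) \<in> ?D" using s(1) sub by (simp add: subgroup.m_closed)
  have comm: "x \<otimes> y = (x \<otimes> y \<otimes> inv x \<otimes> inv y) \<otimes> (y \<otimes> x)"
    if "x \<in> carrier G" "y \<in> carrier G" for x y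
  proof -
    have "inv x \<otimes> inv y \<otimes> (y \<otimes> x) = \<one>" using that by (simp flip: inv_mult_group)
    moreover have "x \<otimes> y \<otimes> inv x \<otimes> inv y \<otimes> (y \<otimes> x)
        = x \<otimes> y \<otimes> (inv x \<otimes> inv y \<otimes> (y \<otimes> x))"
      using that by (simp only: m_assoc m_closed inv_closed)
    ultimately show ?thesis using that by (simp only: r_one m_closed)
  qed
  have "central_commutators G s"
  proof unfold_locales
    fix x y assume xy: "x \<in> carrier G" "y \<in> carrier G"
    show "\<exists>m::nat. x \<otimes> y = (s \<otimes> s \<otimes> (s \<otimes> s)) [^] m \<otimes> (y \<otimes> x)"
      using comm[OF xy] commutator_in_derived[OF xy] gen(1)[OF s4_D s4_ne] by auto
  next
    fix d assume "d \<in> noncentral"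
    then obtain h where d: "d \<in> carrier G" and h: "h \<in> carrier G" "d \<otimes> h \<noteq> h \<otimes> d"
      unfolding noncentral_def by blast
    define c where "c = d \<otimes> h \<otimes> inv d \<otimes> inv h"
    have cD: "c \<in> ?D" unfolding c_def using commutator_in_derived d h by blast
    have cG: "c \<in> carrier G" using cD D_carrier by blast
    have dh: "d \<otimes> h = c \<otimes> (h \<otimes> d)" unfolding c_def using comm d h by blast
    then have "c \<noteq> \<one>" using d h by auto
    moreover have "s \<otimes> s \<in> ?D" using s(1) sub by (simp add: subgroup.m_closed)
    ultimately obtain m :: nat where m: "s \<otimes> s = c [^] m" using gen(1)[OF cD] by auto
    have "d \<otimes> h [^] i = c [^] i \<otimes> (h [^] i \<otimes> d)" for i :: nat
    proof (induction i)
      case (Suc i)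
      have "d \<otimes> h [^] Suc i = c [^] i \<otimes> (h [^] i \<otimes> (d \<otimes> h))"
        using Suc d h cG by (simp flip: m_assoc)
      also have "\<dots> = c [^] i \<otimes> (h [^] i \<otimes> c \<otimes> (h \<otimes> d))"
        unfolding dh using d h cG by (simp add: m_assoc)
      also have "h [^] i \<otimes> c = c \<otimes> h [^] i" using central[OF cD] h by simp
      finally show ?case using d h cG by (simp add: m_assoc)
    qed (use d in simp)
    then show "\<exists>e\<in>carrier G. d \<otimes> e = s \<otimes> s \<otimes> (e \<otimes> d)"
      using m h by (intro bexI[of _ "h [^] m"]) auto
  next
    fix a assume "a \<in> carrier G"
    then show "\<exists>d\<in>carrier G. d \<otimes> d = a" using p_group_square_root[OF p pG] by metis
  qed (fact sG | fact s4_ne | erule central[OF s(1)])+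
  then show ?thesis by blast
qed

section \<open>Multiplication by the central skew element\<close>

context central_commutators
begin

definition z where "z = s \<otimes> s"

lemma z_closed [simp]: "z \<in> carrier G"
  by (simp add: z_def)

lemma z_commute: "x \<in> carrier G \<Longrightarrow> x \<otimes> z = z \<otimes> x"
  unfolding z_def by (metis m_assoc s_central s_closed)

lemma z_left_commute: "x \<in> carrier G \<Longrightarrow> y \<in> carrier G \<Longrightarrow> x \<otimes> (z \<otimes> y) = z \<otimes> (x \<otimes> y)"
  by (metis m_assoc z_commute z_closed)

lemma inv_z_commute: "x \<in> carrier G \<Longrightarrow> x \<otimes> inv z = inv z \<otimes> x"
  by (metis inv_closed inv_solve_left inv_solve_right' m_assoc m_closed z_closed z_commute)

lemma inv_z_left_commute:
  "x \<in> carrier G \<Longrightarrow> y \<in> carrier G \<Longrightarrow> x \<otimes> (inv z \<otimes> y) = inv z \<otimes> (x \<otimes> y)"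
  by (metis m_assoc inv_z_commute z_closed inv_closed)

definition vmult :: "('a \<Rightarrow>\<^sub>0 'f::field) \<Rightarrow> ('a \<Rightarrow>\<^sub>0 'f)" where
  "vmult x = ga_mult G (basis z - basis (inv z)) x"

lemma vmult_single:
  "vmult (Poly_Mapping.single x c) =
    Poly_Mapping.single (z \<otimes> x) c - Poly_Mapping.single (inv z \<otimes> x) c"
  by (simp add: vmult_def ga_mult_diff_left ga_mult_single)

lemma vmult_add: "vmult (x + y) = vmult x + vmult y"
  and vmult_diff: "vmult (x - y) = vmult x - vmult y"
  and vmult_zero: "vmult 0 = 0"
  and vmult_scale: "vmult (ga_scale c x) = ga_scale c (vmult x)"
  by (simp_all add: vmult_def ga_mult_add_right ga_mult_diff_right ga_mult_scale_right)

lemma vmult_closed: "x \<in> group_algebra G \<Longrightarrow> vmult x \<in> group_algebra G"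
  unfolding vmult_def
  by (intro ga_mult_closed group_algebra_diff single_in_group_algebra) auto

lemma vmult_mult_left:
  assumes "x \<in> group_algebra G" "y \<in> group_algebra G"
  shows "ga_mult G (vmult x) y = vmult (ga_mult G x y)"
  unfolding vmult_def using assms
  by (intro ga_mult_assoc group_algebra_diff single_in_group_algebra) auto

lemma vmult_mult_right:
  assumes "x \<in> group_algebra G" "y \<in> group_algebra G"
  shows "ga_mult G x (vmult y) = vmult (ga_mult G x y)"
  using assms(1)
proof (induction rule: group_algebra_induct)
  case (single g a)
  show ?case using assms(2)
    by (induction rule: group_algebra_induct)
      (use single in \<open>auto simp: ga_mult_single vmult_single vmult_add vmult_zero ga_mult_add_right
        ga_mult_diff_right z_left_commute inv_z_left_commute\<close>)
qed (auto simp: ga_mult_add_left vmult_add vmult_zero)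

lemma vmult_bracket:
  "x \<in> group_algebra G \<Longrightarrow> y \<in> group_algebra G \<Longrightarrow>
    lie_bracket G (vmult x) y = vmult (lie_bracket G x y)"
  by (simp add: lie_bracket_def vmult_mult_left vmult_mult_right vmult_diff)

lemma vmult_star: "x \<in> group_algebra G \<Longrightarrow> ga_star G (vmult x) = - vmult (ga_star G x)"
  by (induction rule: group_algebra_induct)
    (auto simp: vmult_single vmult_add vmult_zero ga_star_add ga_star_diff ga_star_single
      inv_mult_group z_commute inv_z_commute)

abbreviation vpow :: "nat \<Rightarrow> ('a \<Rightarrow>\<^sub>0 'f::field) \<Rightarrow> ('a \<Rightarrow>\<^sub>0 'f)" where
  "vpow n \<equiv> vmult ^^ n"

lemma vpow_add: "vpow n (x + y) = vpow n x + vpow n y"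
  and vpow_diff: "vpow n (x - y) = vpow n x - vpow n y"
  and vpow_zero: "vpow n 0 = 0"
  and vpow_scale: "vpow n (ga_scale c x) = ga_scale c (vpow n x)"
  by (induction n) (simp_all add: vmult_add vmult_diff vmult_zero vmult_scale)

lemma vpow_closed: "x \<in> group_algebra G \<Longrightarrow> vpow n x \<in> group_algebra G"
  by (induction n) (simp_all add: vmult_closed)

lemma vpow_bracket:
  assumes "x \<in> group_algebra G" "y \<in> group_algebra G"
  shows "lie_bracket G (vpow n x) y = vpow n (lie_bracket G x y)"
  by (induction n) (simp_all add: assms vmult_bracket vpow_closed)

lemma vpow_star:
  "x \<in> group_algebra G \<Longrightarrow> ga_star G (vpow n x) = ga_scale ((- 1) ^ n) (vpow n (ga_star G x))"
  by (induction n) (simp_all add: vmult_star vpow_closed vmult_scale)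

section \<open>Brackets in the whole group algebra\<close>

definition noncentral_span :: "('a \<Rightarrow>\<^sub>0 'f::field) set" where
  "noncentral_span = {x. Poly_Mapping.keys x \<subseteq> noncentral}"

lemma noncentral_carrier: "d \<in> noncentral \<Longrightarrow> d \<in> carrier G"
  by (simp add: noncentral_def)

lemma noncentral_span_group_algebra: "x \<in> noncentral_span \<Longrightarrow> x \<in> group_algebra G"
  by (auto simp: noncentral_span_def group_algebra_def noncentral_carrier)

lemma subspace_noncentral_span: "ga.subspace noncentral_span"
  unfolding noncentral_span_def by (rule subspace_supported)

lemma subspace_vpow_image:
  assumes "ga.subspace N"
  shows "ga.subspace (vpow n ` N)"
proof (rule ga.subspaceI)
  show "0 \<in> vpow n ` N" using ga.subspace_0[OF assms] vpow_zero by (metis image_eqI)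
qed (use ga.subspace_add[OF assms] ga.subspace_scale[OF assms] in
      \<open>auto simp flip: vpow_add vpow_scale\<close>)

lemma noncentral_z_mult:
  assumes "x \<in> noncentral"
  shows "z \<otimes> x \<in> noncentral"
proof -
  obtain y where y: "y \<in> carrier G" "x \<otimes> y \<noteq> y \<otimes> x" and x: "x \<in> carrier G"
    using assms unfolding noncentral_def by blast
  have "z \<otimes> x \<otimes> y = z \<otimes> (x \<otimes> y)" "y \<otimes> (z \<otimes> x) = z \<otimes> (y \<otimes> x)"
    using x y by (simp_all add: m_assoc z_left_commute)
  moreover have "z \<otimes> (x \<otimes> y) \<noteq> z \<otimes> (y \<otimes> x)" using x y by simp
  ultimately show ?thesis using x y unfolding noncentral_def by force
qed

text \<open>
  If \<open>hg\<close> commuted with \<open>h\<close>, cancelling \<open>h\<close> on the left would give \<open>gh = hg\<close>.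
\<close>

lemma noncentral_mult:
  assumes "g \<in> carrier G" "h \<in> carrier G" "g \<otimes> h \<noteq> h \<otimes> g"
  shows "h \<otimes> g \<in> noncentral"
proof -
  have "h \<otimes> g \<otimes> h \<noteq> h \<otimes> (h \<otimes> g)" using assms by (simp add: m_assoc)
  then show ?thesis using assms unfolding noncentral_def by auto
qed

lemma noncentral_z_power_mult: "x \<in> noncentral \<Longrightarrow> z [^] (i::nat) \<otimes> x \<in> noncentral"
proof (induction i)
  case (Suc i)
  have "z [^] Suc i \<otimes> x = z \<otimes> (z [^] i \<otimes> x)"
    using noncentral_carrier[OF Suc.prems] by (simp add: m_assoc z_left_commute[of "z [^] i"])
  then show ?case using Suc noncentral_z_mult by simp
qed (simp add: noncentral_carrier)

text \<open>
  Division of \<open>z\<^bsup>2m\<^esup> - 1\<close> by \<open>z - z\<inverse>\<close>: the quotient is the sum of the \<open>z\<^bsup>2i+1\<^esup>\<close> for \<open>i < m\<close>, and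
  powers of \<open>z\<close> times a noncentral element stay noncentral.
\<close>

lemma z_power_difference:
  assumes "x \<in> noncentral"
  shows "Poly_Mapping.single ((z \<otimes> z) [^] (m::nat) \<otimes> x) c - Poly_Mapping.single x c
    \<in> vpow 1 ` noncentral_span"
proof -
  have x: "x \<in> carrier G" using assms noncentral_carrier by blast
  note sub = subspace_vpow_image[OF subspace_noncentral_span, of 1]
  show ?thesis
  proof (induction m)
    case 0
    then show ?case using x ga.subspace_0[OF sub] by simp
  next
    case (Suc m)
    define y where "y = (z \<otimes> z) [^] m \<otimes> x"
    have y: "y \<in> noncentral" "y \<in> carrier G"
    proof -
      have "(z \<otimes> z) [^] m = z [^] (m + m)" by (simp add: pow_mult_distrib nat_pow_mult)
      then show "y \<in> noncentral" unfolding y_def using noncentral_z_power_mult[OF assms] by simp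
      then show "y \<in> carrier G" by (rule noncentral_carrier)
    qed
    have "(z \<otimes> z) [^] Suc m \<otimes> x = z \<otimes> (z \<otimes> y)"
      using x unfolding y_def by (simp add: m_assoc z_left_commute[of "(z \<otimes> z) [^] m"])
    moreover have "vpow 1 (Poly_Mapping.single (z \<otimes> y) c)
        = Poly_Mapping.single (z \<otimes> (z \<otimes> y)) c - Poly_Mapping.single y c"
      using y by (simp add: vmult_single flip: m_assoc)
    moreover have "Poly_Mapping.single (z \<otimes> y) c \<in> noncentral_span"
      using y noncentral_z_mult by (simp add: noncentral_span_def)
    ultimately have "Poly_Mapping.single ((z \<otimes> z) [^] Suc m \<otimes> x) c - Poly_Mapping.single y c
        \<in> vpow 1 ` noncentral_span"
      by (metis imageI)
    from ga.subspace_add[OF sub this Suc] show ?case unfolding y_def by simp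
  qed
qed

lemma lie_bracket_in_vmult_noncentral:
  assumes "x \<in> group_algebra G" "y \<in> group_algebra G"
  shows "lie_bracket G x y \<in> vpow 1 ` noncentral_span"
proof -
  note sub = subspace_vpow_image[OF subspace_noncentral_span, of 1]
  show ?thesis using assms(1)
  proof (induction rule: group_algebra_induct)
    case (single g a)
    note g = single
    show ?case using assms(2)
    proof (induction rule: group_algebra_induct)
      case (single h b)
      obtain m :: nat where "g \<otimes> h = (z \<otimes> z) [^] m \<otimes> (h \<otimes> g)"
        using commutator_power[OF g single] unfolding z_def by blast
      then have "lie_bracket G (Poly_Mapping.single g a) (Poly_Mapping.single h b)
          = Poly_Mapping.single ((z \<otimes> z) [^] m \<otimes> (h \<otimes> g)) (a * b)
            - Poly_Mapping.single (h \<otimes> g) (a * b)"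
        by (simp add: lie_bracket_def ga_mult_single mult.commute)
      moreover have "lie_bracket G (Poly_Mapping.single g a) (Poly_Mapping.single h b) = 0"
        if "g \<otimes> h = h \<otimes> g"
        using that by (simp add: lie_bracket_def ga_mult_single mult.commute)
      ultimately show ?case
        using z_power_difference[OF noncentral_mult[OF g single]] ga.subspace_0[OF sub]
        by (cases "g \<otimes> h = h \<otimes> g") auto
    qed (auto simp: lie_bracket_add_right ga.subspace_0[OF sub] intro!: ga.subspace_add[OF sub]
        simp del: funpow.simps One_nat_def)
  qed (auto simp: lie_bracket_add_left ga.subspace_0[OF sub] intro!: ga.subspace_add[OF sub]
      simp del: funpow.simps One_nat_def)
qed

lemma lie_bracket_vpow_image:
  assumes "x \<in> vpow n ` group_algebra G" "y \<in> group_algebra G"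
  shows "lie_bracket G x y \<in> vpow (Suc n) ` noncentral_span"
proof -
  obtain u where u: "u \<in> group_algebra G" "x = vpow n u" using assms by blast
  obtain w where "w \<in> noncentral_span" "lie_bracket G u y = vpow 1 w"
    using lie_bracket_in_vmult_noncentral[OF u(1) assms(2)] by blast
  then show ?thesis
    using vpow_bracket[OF u(1) assms(2), of n] u
    by (intro image_eqI[of _ _ w]) (simp_all add: funpow_swap1)
qed

text \<open>
  Each bracket contributes one factor \<open>v\<close>, which can be moved outside the later brackets as \<open>v\<close> is
  central. At \<open>n = 0\<close> the inclusion fails, because there the central group elements are present; they
  disappear with the first bracket.
\<close>

lemma lower_lie_central_subset_vpow:
  "lower_lie_central G (Suc n) (group_algebra G :: ('a \<Rightarrow>\<^sub>0 'f::field) set)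
    \<subseteq> vpow (Suc n) ` noncentral_span"
proof (rule lower_lie_central_subset[OF subspace_vpow_image[OF subspace_noncentral_span]])
  fix f :: "nat \<Rightarrow> 'a \<Rightarrow>\<^sub>0 'f"
  assume f: "\<forall>i\<le>Suc n. f i \<in> group_algebra G"
  have "lie_commutator G f m \<in> vpow m ` group_algebra G" if "m \<le> n" for m
    using that
  proof (induction m)
    case (Suc m)
    then have "lie_commutator G f (Suc m) \<in> vpow (Suc m) ` noncentral_span"
      using f by (simp del: funpow.simps add: lie_bracket_vpow_image)
    then show ?case using noncentral_span_group_algebra by blast
  qed (use f in simp)
  then show "lie_commutator G f (Suc n) \<in> vpow (Suc n) ` noncentral_span"
    using f by (simp del: funpow.simps add: lie_bracket_vpow_image)
qed

section \<open>Brackets of skew elements\<close>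

definition signed_pair :: "'f::field \<Rightarrow> 'a \<Rightarrow> ('a \<Rightarrow>\<^sub>0 'f)" where
  "signed_pair \<epsilon> x = basis x + Poly_Mapping.single (inv x) \<epsilon>"

lemma signed_pair_closed: "x \<in> carrier G \<Longrightarrow> signed_pair \<epsilon> x \<in> group_algebra G"
  unfolding signed_pair_def by (intro group_algebra_add single_in_group_algebra) auto

lemma signed_pair_skew: "x \<in> carrier G \<Longrightarrow> signed_pair (- 1) x \<in> skew_elements G"
  by (auto simp: skew_elements_def signed_pair_closed)
    (simp add: signed_pair_def ga_star_add ga_star_diff ga_star_single single_uminus)

text \<open>
  Write \<open>a = z h g\<close> and \<open>b = z g h\<inverse>\<close>. Each of the eight products of \<open>g\<close> or \<open>g\<inverse>\<close> with \<open>h\<close> or \<open>h\<inverse>\<close>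
  is \<open>z\<close> or \<open>z\<inverse>\<close> times one of \<open>a\<close>, \<open>a\<inverse>\<close>, \<open>b\<close>, \<open>b\<inverse>\<close>, and the two orders of the factors give opposite
  powers of \<open>z\<close>. So \<open>[g, h] = v a\<close>, \<open>[g, h\<inverse>] = - v b\<close>, \<open>[g\<inverse>, h] = - v b\<inverse>\<close> and
  \<open>[g\<inverse>, h\<inverse>] = v a\<inverse>\<close>.
\<close>

lemma bracket_signed_pair:
  assumes g: "g \<in> carrier G" and h: "h \<in> carrier G" and gh: "g \<otimes> h = z \<otimes> (z \<otimes> (h \<otimes> g))"
  shows "lie_bracket G (signed_pair (- \<epsilon>) g) (signed_pair (- 1) h)
    = vmult (signed_pair \<epsilon> (z \<otimes> (h \<otimes> g)) + signed_pair \<epsilon> (z \<otimes> (g \<otimes> inv h)))"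
proof -
  define a where "a = z \<otimes> (h \<otimes> g)"
  define b where "b = z \<otimes> (g \<otimes> inv h)"
  have ab: "a \<in> carrier G" "b \<in> carrier G" using g h by (simp_all add: a_def b_def)
  have gh': "g \<otimes> h = z \<otimes> a" by (simp add: a_def gh)
  have hg: "h \<otimes> g = inv z \<otimes> a" using g h by (simp add: a_def flip: m_assoc)
  have g_inv_h: "g \<otimes> inv h = inv z \<otimes> b" using g h by (simp add: b_def flip: m_assoc)
  have "h \<otimes> (z \<otimes> b) = z \<otimes> (z \<otimes> (h \<otimes> g)) \<otimes> inv h"
    using g h by (simp add: b_def z_left_commute[OF h] m_assoc)
  also have "\<dots> = g" using g h by (simp add: m_assoc flip: gh)
  finally have inv_h_g: "inv h \<otimes> g = z \<otimes> b" using g h ab by (metis inv_solve_left m_closed z_closed)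
  have "inv g \<otimes> inv h = inv (h \<otimes> g)" using g h by (simp add: inv_mult_group)
  then have ghi: "inv g \<otimes> inv h = z \<otimes> inv a"
    unfolding hg using ab by (simp add: inv_mult_group z_commute)
  have "inv h \<otimes> inv g = inv (g \<otimes> h)" using g h by (simp add: inv_mult_group)
  then have hgi: "inv h \<otimes> inv g = inv z \<otimes> inv a"
    unfolding gh' using ab by (simp add: inv_mult_group inv_z_commute)
  have "inv g \<otimes> h = inv (inv h \<otimes> g)" using g h by (simp add: inv_mult_group)
  then have igh: "inv g \<otimes> h = inv z \<otimes> inv b"
    unfolding inv_h_g using ab by (simp add: inv_mult_group inv_z_commute)
  have "h \<otimes> inv g = inv (g \<otimes> inv h)" using g h by (simp add: inv_mult_group)
  then have hig: "h \<otimes> inv g = z \<otimes> inv b"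
    unfolding g_inv_h using ab by (simp add: inv_mult_group z_commute)
  show ?thesis
    unfolding a_def[symmetric] b_def[symmetric]
    by (simp add: signed_pair_def lie_bracket_def ga_mult_add_left ga_mult_add_right ga_mult_single
        gh' hg g_inv_h inv_h_g ghi hgi igh hig vmult_add vmult_single single_uminus
        ga_mult_diff_left ga_mult_diff_right)
qed

lemma z_square_ne_one: "z \<otimes> z \<noteq> \<one>"
  using s_pow4 by (simp add: z_def)

lemma noncentral_if_z_square:
  assumes "g \<in> carrier G" "h \<in> carrier G" "g \<otimes> h = z \<otimes> (z \<otimes> (h \<otimes> g))"
  shows "g \<in> noncentral"
proof -
  have "g \<otimes> h = z \<otimes> z \<otimes> (h \<otimes> g)" using assms by (simp add: m_assoc)
  then have "g \<otimes> h \<noteq> h \<otimes> g" using z_square_ne_one assms by auto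
  then show ?thesis using assms unfolding noncentral_def by blast
qed

text \<open>
  The bracket formula puts \<open>S(x) + S(y)\<close> into the next term of the series for certain pairs \<open>x\<close>, \<open>y\<close>.
  Three elements of which any two form such a pair are enough to isolate each one of them.
\<close>

lemma vpow_signed_pair_in_skew_central:
  assumes "(2::'f::field) \<noteq> 0" "a \<in> noncentral"
  shows "vpow n (signed_pair (- ((- 1) ^ n)) a :: 'a \<Rightarrow>\<^sub>0 'f)
    \<in> lower_lie_central G n (skew_elements G)"
  using assms(2)
proof (induction n arbitrary: a)
  case 0
  then show ?case
    by (simp add: lower_lie_central_zero[OF subspace_skew] signed_pair_skew noncentral_carrier)
next
  case (Suc n)
  let ?T = "lower_lie_central G (Suc n) (skew_elements G) :: ('a \<Rightarrow>\<^sub>0 'f) set"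
  define S :: "'a \<Rightarrow> ('a \<Rightarrow>\<^sub>0 'f)" where "S x = vpow (Suc n) (signed_pair ((- 1) ^ n) x)" for x
  have T: "ga.subspace ?T" unfolding lower_lie_central_def by simp
  have pair: "S (z \<otimes> (h \<otimes> g)) + S (z \<otimes> (g \<otimes> inv h)) \<in> ?T"
    if gh: "g \<in> carrier G" "h \<in> carrier G" "g \<otimes> h = z \<otimes> (z \<otimes> (h \<otimes> g))" for g h
  proof -
    have "lie_bracket G (vpow n (signed_pair (- ((- 1) ^ n)) g)) (signed_pair (- 1) h) \<in> ?T"
      using Suc.IH[OF noncentral_if_z_square[OF gh]] signed_pair_skew[OF gh(2)]
      by (rule lower_lie_central_bracket)
    then show ?thesis
      using gh unfolding S_def
      by (simp add: vpow_bracket signed_pair_closed bracket_signed_pair vpow_add vmult_add funpow_swap1)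
  qed
  obtain d where d: "d \<in> carrier G" "d \<otimes> d = a"
    using square_root noncentral_carrier[OF Suc.prems] by blast
  have "d \<in> noncentral"
  proof (rule ccontr)
    assume "d \<notin> noncentral"
    then have "d \<otimes> x = x \<otimes> d" if "x \<in> carrier G" for x
      using d that unfolding noncentral_def by blast
    then have "a \<otimes> x = x \<otimes> a" if "x \<in> carrier G" for x
      using d that by (metis m_assoc)
    then show False using Suc.prems unfolding noncentral_def by blast
  qed
  then obtain e where e: "e \<in> carrier G" and de: "d \<otimes> e = z \<otimes> (e \<otimes> d)"
    using noncentral_partner unfolding z_def by blast
  have de': "d \<otimes> (e \<otimes> x) = z \<otimes> (e \<otimes> (d \<otimes> x))" if "x \<in> carrier G" for x
    using d e de that by (metis m_assoc m_closed z_closed)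
  have cancel: "inv u \<otimes> (u \<otimes> x) = x" "u \<otimes> (inv u \<otimes> x) = x"
    if "u \<in> carrier G" "x \<in> carrier G" for u x
    using that by (simp_all flip: m_assoc)
  have inv_d_e: "inv d \<otimes> (e \<otimes> x) = inv z \<otimes> (e \<otimes> (inv d \<otimes> x))" if "x \<in> carrier G" for x
  proof -
    have "d \<otimes> (inv z \<otimes> (e \<otimes> (inv d \<otimes> x))) = e \<otimes> x"
      using d(1) e that by (simp add: inv_z_left_commute[of d] de' cancel)
    then show ?thesis using d(1) e that by (metis cancel(1) inv_closed m_closed z_closed)
  qed
  \<comment> \<open>Normal form: powers of \<open>z\<close> first, then powers of \<open>e\<close>, then powers of \<open>d\<close>.\<close>
  note z_rules = z_commute[OF d(1)] z_commute[OF e] z_left_commute[OF d(1)] z_left_commute[OF e]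
    z_left_commute[of "inv d"] inv_z_left_commute[OF e]
  note rules = m_assoc cancel de de' inv_d_e z_rules
  let ?c = "d \<otimes> (e \<otimes> (e \<otimes> d))"
  have "S (e \<otimes> e) + S (d \<otimes> d) \<in> ?T"
  proof -
    \<comment> \<open>Here the normalising factors \<open>s\<close> of \<open>w(1,1)\<close> and \<open>w(-1,1)\<close> cannot be absorbed into a
      reordering of \<open>d\<close> and \<open>e\<close>. They cancel in \<open>gh\<close> and \<open>hg\<close> and contribute \<open>z\<inverse>\<close> to \<open>gh\<inverse>\<close>.\<close>
    have twist: "inv s \<otimes> x \<otimes> (s \<otimes> y) = x \<otimes> y" "s \<otimes> y \<otimes> (inv s \<otimes> x) = y \<otimes> x"
      "z \<otimes> (inv s \<otimes> x \<otimes> inv (s \<otimes> y)) = x \<otimes> inv y"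
      if "x \<in> carrier G" "y \<in> carrier G" for x y
    proof -
      have s: "x \<otimes> (s \<otimes> y) = s \<otimes> (x \<otimes> y)"
        using that s_central[of x] by (metis m_assoc s_closed)
      then show "inv s \<otimes> x \<otimes> (s \<otimes> y) = x \<otimes> y" using that by (simp add: m_assoc cancel)
      have "s \<otimes> y \<otimes> (inv s \<otimes> x) = y \<otimes> (s \<otimes> (inv s \<otimes> x))"
        using that s_central[of y] by (simp add: m_assoc)
      then show "s \<otimes> y \<otimes> (inv s \<otimes> x) = y \<otimes> x" using that by (simp add: cancel)
      have "z \<otimes> (inv s \<otimes> x \<otimes> inv (s \<otimes> y)) = s \<otimes> (x \<otimes> inv y) \<otimes> inv s"
        using that by (simp add: z_def inv_mult_group m_assoc cancel)
      also have "\<dots> = x \<otimes> inv y"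
        using that s_central[of "x \<otimes> inv y"] by (simp add: m_assoc)
      finally show "z \<otimes> (inv s \<otimes> x \<otimes> inv (s \<otimes> y)) = x \<otimes> inv y" .
    qed
    have "z \<otimes> (inv d \<otimes> e \<otimes> (d \<otimes> e)) = e \<otimes> e"
      "d \<otimes> e \<otimes> (inv d \<otimes> e) = z \<otimes> (z \<otimes> (inv d \<otimes> e \<otimes> (d \<otimes> e)))"
      using d(1) e by (simp_all add: rules)
    moreover have "d \<otimes> e \<otimes> inv (inv d \<otimes> e) = d \<otimes> d"
      using d(1) e by (simp add: m_assoc cancel inv_mult_group)
    ultimately show ?thesis
      using pair[of "inv s \<otimes> (d \<otimes> e)" "s \<otimes> (inv d \<otimes> e)"] d(1) e by (simp add: twist)
  qed
  moreover have "S ?c + S (d \<otimes> d) \<in> ?T"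
  proof -
    have "z \<otimes> (e \<otimes> (d \<otimes> (e \<otimes> d))) = ?c"
      "d \<otimes> (e \<otimes> d) \<otimes> e = z \<otimes> (z \<otimes> (e \<otimes> (d \<otimes> (e \<otimes> d))))"
      using d(1) e by (simp_all add: rules)
    moreover have "z \<otimes> (d \<otimes> (e \<otimes> d) \<otimes> inv e) = d \<otimes> (d \<otimes> e) \<otimes> inv e"
      unfolding de using d(1) e by (simp add: m_assoc z_left_commute[of d])
    moreover have "d \<otimes> (d \<otimes> e) \<otimes> inv e = d \<otimes> d" using d(1) e by (simp add: m_assoc)
    ultimately show ?thesis using pair[of "d \<otimes> (e \<otimes> d)" e] d(1) e by simp
  qed
  moreover have "S (e \<otimes> e) + S ?c \<in> ?T"
  proof -
    have "z \<otimes> (inv d \<otimes> (e \<otimes> (d \<otimes> e))) = e \<otimes> e"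
      "e \<otimes> (d \<otimes> e) \<otimes> inv d = z \<otimes> (z \<otimes> (inv d \<otimes> (e \<otimes> (d \<otimes> e))))"
      "z \<otimes> (e \<otimes> (d \<otimes> e) \<otimes> inv (inv d)) = ?c"
      using d(1) e by (simp_all add: rules)
    then show ?thesis using pair[of "e \<otimes> (d \<otimes> e)" "inv d"] d(1) e by simp
  qed
  ultimately have "(S (e \<otimes> e) + S (d \<otimes> d)) + (S ?c + S (d \<otimes> d)) - (S (e \<otimes> e) + S ?c) \<in> ?T"
    by (metis T ga.subspace_add ga.subspace_diff)
  then have "S (d \<otimes> d) + S (d \<otimes> d) \<in> ?T" by (simp add: algebra_simps)
  then have "ga_scale (1 / 2) (S (d \<otimes> d) + S (d \<otimes> d)) \<in> ?T" by (rule ga.subspace_scale[OF T])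
  moreover have "ga_scale (1 / 2) (x + x) = x" for x :: "'a \<Rightarrow>\<^sub>0 'f"
    using assms(1) by (intro poly_mapping_eqI) (simp add: lookup_add field_simps)
  ultimately show ?case using d by (simp add: S_def)
qed

lemma vpow_skew_part_in_skew_central:
  assumes "(2::'f::field) \<noteq> 0" "y \<in> noncentral_span"
  shows "vpow n (y - ga_scale ((- 1) ^ n) (ga_star G y) :: 'a \<Rightarrow>\<^sub>0 'f)
    \<in> lower_lie_central G n (skew_elements G)"
proof -
  have T: "ga.subspace (lower_lie_central G n (skew_elements G) :: ('a \<Rightarrow>\<^sub>0 'f) set)"
    unfolding lower_lie_central_def by simp
  show ?thesis using assms(2) unfolding noncentral_span_def mem_Collect_eq
  proof (induction rule: supported_induct)
    case (single g c)
    have "Poly_Mapping.single g c - ga_scale ((- 1) ^ n) (ga_star G (Poly_Mapping.single g c))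
        = ga_scale c (signed_pair (- ((- 1) ^ n)) g)"
      by (simp add: ga_star_single signed_pair_def ga.scale_right_diff_distrib
          single_uminus mult.commute)
    then show ?case
      using vpow_signed_pair_in_skew_central[OF assms(1) single, of n]
      by (simp add: vpow_scale ga.subspace_scale[OF T])
  next
    case (add x y)
    from ga.subspace_add[OF T add.IH] show ?case
      by (simp add: ga_star_add ga.scale_right_distrib vpow_add vpow_diff algebra_simps)
  qed (simp add: vpow_zero ga.subspace_0[OF T])
qed

lemma lower_lie_central_skew_eq:
  assumes "(2::'f::field) \<noteq> 0"
  shows "lower_lie_central G n (skew_elements G :: ('a \<Rightarrow>\<^sub>0 'f) set)
    = lower_lie_central G n (group_algebra G) \<inter> skew_elements G"
proof (intro equalityI subsetI)
  fix w :: "'a \<Rightarrow>\<^sub>0 'f"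
  assume "w \<in> lower_lie_central G n (skew_elements G)"
  moreover have "skew_elements G \<subseteq> (group_algebra G :: ('a \<Rightarrow>\<^sub>0 'f) set)"
    by (auto simp: skew_elements_def)
  ultimately show "w \<in> lower_lie_central G n (group_algebra G) \<inter> skew_elements G"
    using lower_lie_central_mono lower_lie_central_skew by blast
next
  fix w :: "'a \<Rightarrow>\<^sub>0 'f"
  assume w: "w \<in> lower_lie_central G n (group_algebra G) \<inter> skew_elements G"
  show "w \<in> lower_lie_central G n (skew_elements G)"
  proof (cases n)
    case 0
    then show ?thesis using w by (simp add: lower_lie_central_zero[OF subspace_skew])
  next
    case (Suc m)
    then obtain y where y: "y \<in> noncentral_span" "w = vpow n y"
      using w lower_lie_central_subset_vpow[of m] by blast
    have "ga_star G w = - w" using w by (simp add: skew_elements_def)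
    then have "vpow n (y - ga_scale ((- 1) ^ n) (ga_star G y)) = w + w"
      using vpow_star[OF noncentral_span_group_algebra[OF y(1)], of n] y(2)
      by (simp add: vpow_diff vpow_scale)
    then have "ga_scale (1 / 2) (w + w) \<in> lower_lie_central G n (skew_elements G)"
      using vpow_skew_part_in_skew_central[OF assms y(1), of n]
      unfolding lower_lie_central_def by (simp add: ga.span_scale)
    moreover have "ga_scale (1 / 2) (w + w) = w"
      using assms by (intro poly_mapping_eqI) (simp add: lookup_add field_simps)
    ultimately show ?thesis by simp
  qed
qed

end

theorem theorem1:
  fixes G :: "('g, 'm) monoid_scheme" and p n :: nat
  assumes "Factorial_Ring.prime p" and "p > 2"
    and "p_group p G"
    and "card (derived G (carrier G)) = p"
    and "CHAR('f::field) = p"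
  shows "lower_lie_central G n (skew_elements G :: ('g \<Rightarrow>\<^sub>0 'f) set) =
         lower_lie_central G n (group_algebra G) \<inter> skew_elements G"
proof -
  obtain s where "central_commutators G s"
    using p_group_central_commutators[OF assms(1-4)] by blast
  moreover have "(2::'f) \<noteq> 0"
    using of_nat_eq_0_iff_char_dvd[where 'a = 'f, of 2] assms(2,5) by (auto dest: dvd_imp_le)
  ultimately show ?thesis by (rule central_commutators.lower_lie_central_skew_eq)
qed

end
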